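(* Let $k,d\ge 0$ be integers. Let $M$ be a torsion-free FI-module generated in degree $\le k$, and let $V\subset M$ be a sub-FI-module generated in degree $\le d$. Then for all $n>\min(k,d)+d$ and any $a\le n$ (with $n,a\in\mathbb{N}$), $$V_n\cap\big(M_{[n]-\{1\}}+\cdots+M_{[n]-\{a\}}\big)=V_{[n]-\{1\}}+\cdots+V_{[n]-\{a\}}$$ as subgroups of $M_n$.
   Context: $\mathrm{FI}$ is the category of finite sets and injections. An FI-module is a functor $W\colon \mathrm{FI}\to \mathbb{Z}\text{-Mod}$; write $W_T=W(T)$, $[n]=\{1,\dots,n\}$, $W_n=W_{[n]}$, and $f_*\colon W_S\to W_T$ for the map induced by an injection $f$. Degree: $\deg W=\inf\{k\in\{-\infty\}\cup\mathbb{N}\cup\{\infty\}\mid W_n=0\text{ for all }n\in\mathbb{N}\text{ with }n>k\}$. Define $H_0(W)_T=W_T/\operatorname{span}(\operatorname{im} f_*\colon W_S\to W_T\mid f\colon S\hookrightarrow T,\ |S|<|T|)$. $W$ is generated in degree $\le m$ if $\deg H_0(W)\le m$. An FI-module $M$ is torsion-free if $f_*\colon M_S\to M_T$ is injective for every injection $f\colon S\hookrightarrow T$ of finite sets. In this case, for $S\subset T$, $M_S$ is identified with its image in $M_T$ under the map induced by the inclusion $S\subset T$; similarly for $V_S\subset V_T\subset M_T$. *)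

theory Defs
  imports
    "HOL-Algebra.Elementary_Groups"
    "HOL-Algebra.FiniteProduct"
    "HOL-Library.FuncSet"
    "HOL-Library.Extended_Real"
begin

text \<open>
  The category FI is represented by its full subcategory on the finite sets of natural numbers,
  which contains every \<open>[n] = {1..n}\<close> and is equivalent to FI.  An injection \<open>S \<hookrightarrow> T\<close> is a function
  that is undefined outside \<open>S\<close>, so that equality of morphisms is equality of functions.

  \<open>\<int>\<close>-modules are the abelian groups of HOL-Algebra, which are written multiplicatively; sums of
  subgroups, spans and zero modules below therefore appear as products, generated subgroups and
  trivial groups.
\<close>

definition FI_hom :: "nat set \<Rightarrow> nat set \<Rightarrow> (nat \<Rightarrow> nat) set" where
  "FI_hom S T = {f \<in> S \<rightarrow>\<^sub>E T. inj_on f S}"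

definition FI_incl :: "nat set \<Rightarrow> nat \<Rightarrow> nat" where
  "FI_incl S = (\<lambda>x\<in>S. x)"

record 'a FI_data =
  fi_obj :: "nat set \<Rightarrow> 'a monoid"
  fi_map :: "nat set \<Rightarrow> nat set \<Rightarrow> (nat \<Rightarrow> nat) \<Rightarrow> 'a \<Rightarrow> 'a"

locale FI_module =
  fixes W :: "'a FI_data"
  assumes comm_group_obj: "finite T \<Longrightarrow> comm_group (fi_obj W T)"
    and map_hom: "\<lbrakk>finite S; finite T; f \<in> FI_hom S T\<rbrakk>
          \<Longrightarrow> fi_map W S T f \<in> hom (fi_obj W S) (fi_obj W T)"
    and map_id: "\<lbrakk>finite T; x \<in> carrier (fi_obj W T)\<rbrakk>
          \<Longrightarrow> fi_map W T T (FI_incl T) x = x"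
    and map_compose: "\<lbrakk>finite S; finite T; finite U; f \<in> FI_hom S T; g \<in> FI_hom T U;
          x \<in> carrier (fi_obj W S)\<rbrakk>
          \<Longrightarrow> fi_map W S U (compose S g f) x = fi_map W T U g (fi_map W S T f x)"

definition FI_degree :: "'a FI_data \<Rightarrow> ereal" where
  "FI_degree W = Inf {k \<in> {-\<infinity>} \<union> range (\<lambda>n::nat. ereal (real n)) \<union> {\<infinity>}.
     \<forall>n::nat. ereal (real n) > k \<longrightarrow> trivial_group (fi_obj W {1..n})}"

definition FI_lower_span :: "'a FI_data \<Rightarrow> nat set \<Rightarrow> 'a set" where
  "FI_lower_span W T = generate (fi_obj W T)
     (\<Union>{fi_map W S T f ` carrier (fi_obj W S) | S f.
          finite S \<and> f \<in> FI_hom S T \<and> card S < card T})"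

text \<open>The maps of \<open>H\<^sub>0(W)\<close> are the induced ones: the coset of \<open>x\<close> is sent to the coset of \<open>f\<^sub>* x\<close>.\<close>

definition FI_H0 :: "'a FI_data \<Rightarrow> 'a set FI_data" where
  "FI_H0 W = \<lparr>fi_obj = (\<lambda>T. fi_obj W T Mod FI_lower_span W T),
     fi_map = (\<lambda>S T f X. \<Union>x\<in>X. FI_lower_span W T #>\<^bsub>fi_obj W T\<^esub> fi_map W S T f x)\<rparr>"

definition FI_generated_in_degree :: "'a FI_data \<Rightarrow> nat \<Rightarrow> bool" where
  "FI_generated_in_degree W m \<longleftrightarrow> FI_degree (FI_H0 W) \<le> ereal (real m)"

definition FI_torsion_free :: "'a FI_data \<Rightarrow> bool" where
  "FI_torsion_free M \<longleftrightarrow> (\<forall>S T f. finite S \<longrightarrow> finite T \<longrightarrow> f \<in> FI_hom S T \<longrightarrow>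
     inj_on (fi_map M S T f) (carrier (fi_obj M S)))"

text \<open>
  A sub-FI-module of \<open>M\<close> is given by the underlying sets \<open>V T\<close>; \<open>sub_FI_data M V\<close> is the
  resulting FI-module.
\<close>

definition sub_FI_module :: "(nat set \<Rightarrow> 'a set) \<Rightarrow> 'a FI_data \<Rightarrow> bool" where
  "sub_FI_module V M \<longleftrightarrow> (\<forall>T. finite T \<longrightarrow> subgroup (V T) (fi_obj M T)) \<and>
     (\<forall>S T f. finite S \<longrightarrow> finite T \<longrightarrow> f \<in> FI_hom S T \<longrightarrow> fi_map M S T f ` V S \<subseteq> V T)"

definition sub_FI_data :: "'a FI_data \<Rightarrow> (nat set \<Rightarrow> 'a set) \<Rightarrow> 'a FI_data" where
  "sub_FI_data M V = \<lparr>fi_obj = (\<lambda>T. (fi_obj M T)\<lparr>carrier := V T\<rparr>), fi_map = fi_map M\<rparr>"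

text \<open>
  \<open>FI_image M S T A\<close> is the copy inside \<open>M\<^sub>T\<close> of a subset \<open>A\<close> of \<open>M\<^sub>S\<close>, for \<open>S \<subseteq> T\<close>.
\<close>

definition FI_image :: "'a FI_data \<Rightarrow> nat set \<Rightarrow> nat set \<Rightarrow> 'a set \<Rightarrow> 'a set" where
  "FI_image M S T A = fi_map M S T (FI_incl S) ` A"

text \<open>The sum \<open>\<Sum>i\<in>I. A i\<close> of finitely many subgroups; it is the zero subgroup if \<open>I\<close> is empty.\<close>

definition subgroup_sum :: "'a monoid \<Rightarrow> 'i set \<Rightarrow> ('i \<Rightarrow> 'a set) \<Rightarrow> 'a set" where
  "subgroup_sum G I A = {finprod G x I | x. x \<in> (\<Pi> i\<in>I. A i)}"

lemma FI_module_sub_FI_data: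
  assumes "FI_module M" and "sub_FI_module V M"
  shows "FI_module (sub_FI_data M V)"
proof -
  interpret FI_module M by fact
  have sub: "finite T \<Longrightarrow> subgroup (V T) (fi_obj M T)" for T
    using assms(2) by (simp add: sub_FI_module_def)
  have closed: "\<lbrakk>finite S; finite T; f \<in> FI_hom S T; x \<in> V S\<rbrakk> \<Longrightarrow> fi_map M S T f x \<in> V T" for S T f x
    using assms(2) unfolding sub_FI_module_def by (meson image_subset_iff)
  have inc: "\<lbrakk>finite T; x \<in> V T\<rbrakk> \<Longrightarrow> x \<in> carrier (fi_obj M T)" for T x
    using sub subgroup.mem_carrier by fast
  show ?thesis
  proof (rule FI_module.intro)
    fix T :: "nat set" assume T: "finite T"
    interpret comm_group "fi_obj M T" using T by (rule comm_group_obj)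
    have "group ((fi_obj M T)\<lparr>carrier := V T\<rparr>)"
      using sub[OF T] is_group by (rule subgroup.subgroup_is_group)
    then show "comm_group (fi_obj (sub_FI_data M V) T)"
      unfolding sub_FI_data_def
      by (auto intro!: group.group_comm_groupI simp: m_comm inc[OF T])
  next
    fix S T f assume *: "finite S" "finite T" "f \<in> FI_hom S T"
    then show "fi_map (sub_FI_data M V) S T f
        \<in> hom (fi_obj (sub_FI_data M V) S) (fi_obj (sub_FI_data M V) T)"
      using map_hom[OF *] closed[OF *] inc[OF *(1)] by (auto simp: sub_FI_data_def hom_def)
  next
    fix T x assume "finite T" "x \<in> carrier (fi_obj (sub_FI_data M V) T)"
    then show "fi_map (sub_FI_data M V) T T (FI_incl T) x = x"
      using map_id[OF _ inc] by (simp add: sub_FI_data_def)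
  next
    fix S T U f g x
    assume *: "finite S" "finite T" "finite U" "f \<in> FI_hom S T" "g \<in> FI_hom T U"
      and "x \<in> carrier (fi_obj (sub_FI_data M V) S)"
    then show "fi_map (sub_FI_data M V) S U (compose S g f) x
        = fi_map (sub_FI_data M V) T U g (fi_map (sub_FI_data M V) S T f x)"
      using map_compose[OF * inc] by (simp add: sub_FI_data_def)
  qed
qed

lemma FI_hom_compose: "\<lbrakk>f \<in> FI_hom S T; g \<in> FI_hom T U\<rbrakk> \<Longrightarrow> compose S g f \<in> FI_hom S U"
  by (auto simp: FI_hom_def compose_def inj_on_def PiE_iff)

lemma FI_incl_hom: "S \<subseteq> T \<Longrightarrow> FI_incl S \<in> FI_hom S T"
  by (auto simp: FI_hom_def FI_incl_def inj_on_def)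

context FI_module
begin

lemma lower_span_subgroup:
  assumes "finite T"
  shows "subgroup (FI_lower_span W T) (fi_obj W T)"
proof -
  interpret comm_group "fi_obj W T" using assms by (rule comm_group_obj)
  show ?thesis
    unfolding FI_lower_span_def
  proof (rule generate_is_subgroup, safe)
    fix x S f y
    assume "finite S" "f \<in> FI_hom S T" "y \<in> carrier (fi_obj W S)"
    then show "fi_map W S T f y \<in> carrier (fi_obj W T)"
      using map_hom[of S T f] assms by (auto simp: hom_def)
  qed
qed

lemma map_lower_span:
  assumes "finite S" "finite T" "f \<in> FI_hom S T"
  shows "fi_map W S T f ` FI_lower_span W S \<subseteq> FI_lower_span W T"
proof -
  interpret S: comm_group "fi_obj W S" using assms(1) by (rule comm_group_obj)
  interpret T: comm_group "fi_obj W T" using assms(2) by (rule comm_group_obj)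
  interpret group_hom "fi_obj W S" "fi_obj W T" "fi_map W S T f"
    by unfold_locales (rule map_hom[OF assms])
  let ?G = "\<lambda>T. \<Union>{fi_map W S T f ` carrier (fi_obj W S) | S f.
          finite S \<and> f \<in> FI_hom S T \<and> card S < card T}"
  have card: "card S \<le> card T"
    using assms by (auto simp: FI_hom_def PiE_iff intro!: card_inj_on_le)
  have sub: "?G S \<subseteq> carrier (fi_obj W S)"
  proof safe
    fix x R g y
    assume "finite R" "g \<in> FI_hom R S" "y \<in> carrier (fi_obj W R)"
    then show "fi_map W R S g y \<in> carrier (fi_obj W S)"
      using map_hom[of R S g] assms(1) by (auto simp: hom_def)
  qed
  have "fi_map W S T f ` ?G S \<subseteq> ?G T"
  proof safe
    fix R g y
    assume *: "finite R" "g \<in> FI_hom R S" "card R < card S" "y \<in> carrier (fi_obj W R)"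
    then have "fi_map W S T f (fi_map W R S g y) = fi_map W R T (compose R f g) y"
      using map_compose assms by simp
    moreover have "compose R f g \<in> FI_hom R T" "card R < card T"
      using * assms card FI_hom_compose by auto
    ultimately show "fi_map W S T f (fi_map W R S g y) \<in> ?G T"
      using * by blast
  qed
  from T.mono_generate[OF this] show ?thesis
    unfolding FI_lower_span_def generate_img[OF sub] .
qed

lemma H0_map_coset:
  assumes "finite S" "finite T" "f \<in> FI_hom S T" and x: "x \<in> carrier (fi_obj W S)"
  shows "fi_map (FI_H0 W) S T f (FI_lower_span W S #>\<^bsub>fi_obj W S\<^esub> x)
       = FI_lower_span W T #>\<^bsub>fi_obj W T\<^esub> fi_map W S T f x"
proof -
  interpret S: comm_group "fi_obj W S" using assms(1) by (rule comm_group_obj)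
  interpret T: comm_group "fi_obj W T" using assms(2) by (rule comm_group_obj)
  interpret group_hom "fi_obj W S" "fi_obj W T" "fi_map W S T f"
    by unfold_locales (rule map_hom[OF assms(1-3)])
  note subS = lower_span_subgroup[OF assms(1)] and subT = lower_span_subgroup[OF assms(2)]
  have "FI_lower_span W T #>\<^bsub>fi_obj W T\<^esub> fi_map W S T f y
      = FI_lower_span W T #>\<^bsub>fi_obj W T\<^esub> fi_map W S T f x"
    if y: "y \<in> FI_lower_span W S #>\<^bsub>fi_obj W S\<^esub> x" for y
  proof -
    obtain h where h: "h \<in> FI_lower_span W S" "y = h \<otimes>\<^bsub>fi_obj W S\<^esub> x"
      using y by (auto simp: r_coset_def)
    have hc: "h \<in> carrier (fi_obj W S)" using h subS subgroup.mem_carrier by fast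
    have fh: "fi_map W S T f h \<in> FI_lower_span W T"
      using h map_lower_span[OF assms(1-3)] by auto
    have "fi_map W S T f y = fi_map W S T f h \<otimes>\<^bsub>fi_obj W T\<^esub> fi_map W S T f x"
      using h hc x by simp
    then have "fi_map W S T f y \<in> FI_lower_span W T #>\<^bsub>fi_obj W T\<^esub> fi_map W S T f x"
      using fh by (auto simp: r_coset_def)
    then show ?thesis
      using T.repr_independence[OF _ _ subT] x by simp
  qed
  moreover have "x \<in> FI_lower_span W S #>\<^bsub>fi_obj W S\<^esub> x"
    using S.rcos_self[OF x subS] .
  ultimately have "(\<Union>y\<in>FI_lower_span W S #>\<^bsub>fi_obj W S\<^esub> x.
      FI_lower_span W T #>\<^bsub>fi_obj W T\<^esub> fi_map W S T f y)
      = FI_lower_span W T #>\<^bsub>fi_obj W T\<^esub> fi_map W S T f x"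
    by blast
  then show ?thesis
    by (simp add: FI_H0_def)
qed

lemma FI_module_H0: "FI_module (FI_H0 W)"
proof (rule FI_module.intro)
  fix T :: "nat set" assume T: "finite T"
  then show "comm_group (fi_obj (FI_H0 W) T)"
    by (simp add: FI_H0_def comm_group.abelian_FactGroup comm_group_obj lower_span_subgroup)
next
  fix S T f assume *: "finite S" "finite T" "f \<in> FI_hom S T"
  interpret S: comm_group "fi_obj W S" using *(1) by (rule comm_group_obj)
  interpret T: comm_group "fi_obj W T" using *(2) by (rule comm_group_obj)
  interpret group_hom "fi_obj W S" "fi_obj W T" "fi_map W S T f"
    by unfold_locales (rule map_hom[OF *])
  interpret NS: normal "FI_lower_span W S" "fi_obj W S"
    by (simp add: S.normal_iff_subgroup lower_span_subgroup *)
  interpret NT: normal "FI_lower_span W T" "fi_obj W T"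
    by (simp add: T.normal_iff_subgroup lower_span_subgroup *)
  have obj: "fi_obj (FI_H0 W) = (\<lambda>T. fi_obj W T Mod FI_lower_span W T)"
    by (simp add: FI_H0_def)
  show "fi_map (FI_H0 W) S T f \<in> hom (fi_obj (FI_H0 W) S) (fi_obj (FI_H0 W) T)"
    unfolding obj
    by (rule homI) (auto simp: carrier_FactGroup H0_map_coset[OF *] NS.rcos_sum NT.rcos_sum)
next
  fix T X assume T: "finite T" and "X \<in> carrier (fi_obj (FI_H0 W) T)"
  then obtain x where x: "x \<in> carrier (fi_obj W T)" "X = FI_lower_span W T #>\<^bsub>fi_obj W T\<^esub> x"
    by (auto simp: FI_H0_def carrier_FactGroup)
  show "fi_map (FI_H0 W) T T (FI_incl T) X = X"
    unfolding x(2) H0_map_coset[OF T T FI_incl_hom[OF subset_refl] x(1)] map_id[OF T x(1)] ..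
next
  fix S T U f g X
  assume *: "finite S" "finite T" "finite U" "f \<in> FI_hom S T" "g \<in> FI_hom T U"
    and "X \<in> carrier (fi_obj (FI_H0 W) S)"
  then obtain x where x: "x \<in> carrier (fi_obj W S)" "X = FI_lower_span W S #>\<^bsub>fi_obj W S\<^esub> x"
    by (auto simp: FI_H0_def carrier_FactGroup)
  have "fi_map W S T f x \<in> carrier (fi_obj W T)"
    using map_hom[OF *(1,2,4)] x by (auto simp: hom_def)
  then show "fi_map (FI_H0 W) S U (compose S g f) X
      = fi_map (FI_H0 W) T U g (fi_map (FI_H0 W) S T f X)"
    using * x by (simp add: H0_map_coset FI_hom_compose map_compose)
qed

end

end

theory Submission
  imports Defs "HOL-Combinatorics.Transposition"
begin

text \<open>
  Everything takes place inside \<open>M\<^bsub>[2n]\<^esub>\<close>, on which transpositions act; the points \<open>n+1, \<dots>, 2n\<close> serve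
  as positions outside \<open>[n]\<close>.  Put \<open>m = min k d\<close>.  A product of \<open>m + 1\<close> differences \<open>1 - (i j)\<close> with
  disjoint transpositions kills \<open>V\<close>: each of the generating subsets, of \<open>V\<close> or of \<open>M\<close>, has at most
  \<open>m\<close> elements and so misses some pair.

  The theorem holds for every family \<open>V\<close> that is generated in degree \<open>d\<close> and killed by these products,
  by induction on \<open>m\<close> and reverse induction on the size of \<open>A = [a]\<close>.  If \<open>a > m\<close>, the products
  already show that \<open>V\<^sub>n\<close> is the sum of the \<open>V\<^bsub>[n]-i\<^esub>\<close> with \<open>i \<in> A\<close>.  Otherwise the hypothesis for \<open>A \<union> {c}\<close>
  reduces the claim to an element \<open>w\<close> of \<open>V\<^bsub>[n]-c\<^esub>\<close>.  Choose \<open>b \<in> A\<close> and a point \<open>b'\<close> outside \<open>[n]\<close>.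
  The family \<open>T \<mapsto> (1 - (b b')) V\<^bsub>T \<union> b\<^esub>\<close> is generated in degree \<open>d - 1\<close> and killed by products of \<open>m\<close>
  differences.  The hypothesis for \<open>m - 1\<close> therefore changes \<open>w\<close>, modulo the \<open>V\<^bsub>[n]-i\<^esub>\<close> with \<open>i \<in> A\<close>, into
  an element \<open>x\<close> of \<open>V\<^bsub>[n]-c\<^esub>\<close> fixed by \<open>(b b')\<close>.  Then \<open>x = (b' c) (b b') x\<close> lies in \<open>V\<^bsub>[n]-b\<^esub>\<close>.
\<close>

section \<open>Sums and generated subgroups in abelian groups\<close>

text \<open>Splits one summand off a sum: with \<open>B = V (T - {c})\<close> it isolates the part
  of an element that belongs to a newly added point \<open>c\<close>.\<close>

lemma (in comm_group) generate_Un_subgroups: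
  assumes "A \<subseteq> carrier G" "subgroup B G"
  shows "generate G (A \<union> B) \<subseteq> generate G A <#> B"
proof (rule generate_subgroup_incl)
  have A: "subgroup (generate G A) G"
    using assms(1) by (rule generate_is_subgroup)
  show "subgroup (generate G A <#> B) G"
    using A assms(2) by (rule mult_subgroups)
  have "x \<in> generate G A <#> B" if "x \<in> A" for x
    using that assms generate.incl[OF that, of G] subgroup.one_closed[OF assms(2)]
    by (force simp: set_mult_def)
  moreover have "x \<in> generate G A <#> B" if "x \<in> B" for x
    using that subgroup.mem_carrier[OF assms(2) that] generate.one[of G A]
    by (force simp: set_mult_def)
  ultimately show "A \<union> B \<subseteq> generate G A <#> B"
    by blast
qed

text \<open>Passes to \<open>generate\<close>, which commutes with images under homomorphisms. The
  products \<open>finprod G x I\<close> already form a subgroup that contains every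
  \<open>A i\<close>.\<close>

lemma subgroup_sum_eq_generate:
  fixes G :: "'a monoid" (structure)
  assumes "comm_group G" and "finite I" and sub: "\<And>i. i \<in> I \<Longrightarrow> subgroup (A i) G"
  shows "subgroup_sum G I A = generate G (\<Union>i\<in>I. A i)"
proof
  interpret comm_group G by fact
  have car: "(\<Union>i\<in>I. A i) \<subseteq> carrier G"
    using sub subgroup.mem_carrier by fast
  have gen: "subgroup (generate G (\<Union>i\<in>I. A i)) G"
    using car by (rule generate_is_subgroup)
  have cl: "x \<in> I \<rightarrow> carrier G" if "x \<in> (\<Pi> i\<in>I. A i)" for x
    using that car by blast
  have "finprod G x J \<in> generate G (\<Union>i\<in>I. A i)" if x: "x \<in> (\<Pi> i\<in>I. A i)" and "J \<subseteq> I" for x J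
    using finite_subset[OF that(2) assms(2)] that(2)
  proof (induction J)
    case empty
    then show ?case by (simp add: generate.one)
  next
    case (insert j J)
    then have "finprod G x (insert j J) = x j \<otimes> finprod G x J"
      using cl[OF x] by (intro finprod_insert) auto
    moreover have "x j \<in> generate G (\<Union>i\<in>I. A i)"
      using insert x by (auto intro: generate.incl)
    ultimately show ?case
      using insert by (auto intro: generate.eng)
  qed
  then show "subgroup_sum G I A \<subseteq> generate G (\<Union>i\<in>I. A i)"
    by (auto simp: subgroup_sum_def)
  show "generate G (\<Union>i\<in>I. A i) \<subseteq> subgroup_sum G I A"
  proof (rule generate_subgroup_incl)
    show "(\<Union>i\<in>I. A i) \<subseteq> subgroup_sum G I A"
    proof safe
      fix i a assume i: "i \<in> I" and a: "a \<in> A i"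
      let ?x = "\<lambda>j. if i = j then a else \<one>"
      have "?x \<in> (\<Pi> i\<in>I. A i)"
        using a subgroup.one_closed[OF sub] by (simp add: Pi_iff)
      moreover have "finprod G ?x I = a"
        using finprod_singleton[OF i assms(2), of "\<lambda>_. a"] car i a by auto
      ultimately show "a \<in> subgroup_sum G I A"
        unfolding subgroup_sum_def by (intro CollectI exI[of _ ?x]) simp
    qed
    show "subgroup (subgroup_sum G I A) G"
    proof (rule subgroup.intro)
      show "subgroup_sum G I A \<subseteq> carrier G"
        using cl by (auto simp: subgroup_sum_def intro!: finprod_closed)
      show "\<one> \<in> subgroup_sum G I A"
        unfolding subgroup_sum_def
        using subgroup.one_closed[OF sub] by (auto intro!: exI[of _ "\<lambda>_. \<one>"])
      fix u assume "u \<in> subgroup_sum G I A"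
      then obtain x where x: "x \<in> (\<Pi> i\<in>I. A i)" "u = finprod G x I"
        by (auto simp: subgroup_sum_def)
      have "(\<lambda>i. inv (x i)) \<in> (\<Pi> i\<in>I. A i)"
        using x(1) sub subgroup.m_inv_closed by fast
      moreover have "inv u \<otimes> u = finprod G (\<lambda>i. inv (x i)) I \<otimes> u"
      proof -
        have "finprod G (\<lambda>i. inv (x i)) I \<otimes> u = finprod G (\<lambda>i. inv (x i) \<otimes> x i) I"
          using cl[OF x(1)] unfolding x(2) by (intro finprod_multf[symmetric]) auto
        also have "\<dots> = \<one>"
          using cl[OF x(1)] by (intro finprod_one_eqI) (simp add: Pi_iff)
        finally show ?thesis
          using cl[OF x(1)] x(2) by simp
      qed
      then have "inv u = finprod G (\<lambda>i. inv (x i)) I"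
        using cl[OF x(1)] unfolding x(2) by (subst (asm) right_cancel) (auto intro!: finprod_closed)
      ultimately show "inv u \<in> subgroup_sum G I A"
        by (auto simp: subgroup_sum_def)
      fix v assume "v \<in> subgroup_sum G I A"
      then obtain y where y: "y \<in> (\<Pi> i\<in>I. A i)" "v = finprod G y I"
        by (auto simp: subgroup_sum_def)
      have "(\<lambda>i. x i \<otimes> y i) \<in> (\<Pi> i\<in>I. A i)"
        using x(1) y(1) sub subgroup.m_closed by fast
      moreover have "u \<otimes> v = finprod G (\<lambda>i. x i \<otimes> y i) I"
        using cl[OF x(1)] cl[OF y(1)] unfolding x(2) y(2) by (intro finprod_multf[symmetric]) auto
      ultimately show "u \<otimes> v \<in> subgroup_sum G I A"
        by (auto simp: subgroup_sum_def)
    qed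
  qed
qed

section \<open>Transpositions acting on an abelian group\<close>

locale transposition_action = comm_group G for G (structure) +
  fixes \<tau> :: "nat \<Rightarrow> nat \<Rightarrow> 'a \<Rightarrow> 'a" and N :: "nat set"
  assumes action_hom: "\<lbrakk>i \<in> N; j \<in> N\<rbrakk> \<Longrightarrow> \<tau> i j \<in> hom G G"
    and action_commute: "\<lbrakk>i \<in> N; j \<in> N; k \<in> N; l \<in> N; i \<noteq> k; i \<noteq> l; j \<noteq> k; j \<noteq> l; x \<in> carrier G\<rbrakk>
      \<Longrightarrow> \<tau> i j (\<tau> k l x) = \<tau> k l (\<tau> i j x)"
begin

text \<open>The group ring element \<open>1 - (i j)\<close>, acting on a module written
  multiplicatively.\<close>

definition diff :: "nat \<Rightarrow> nat \<Rightarrow> 'a \<Rightarrow> 'a" where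
  "diff i j x = x \<otimes> inv (\<tau> i j x)"

text \<open>The head acts first, so a pair put in front of the list acts before the remaining
  product; the passage to a derived family relies on this order.\<close>

primrec iter_diff :: "(nat \<times> nat) list \<Rightarrow> 'a \<Rightarrow> 'a" where
  "iter_diff [] x = x"
| "iter_diff (p # ps) x = iter_diff ps (diff (fst p) (snd p) x)"

definition fixed :: "nat \<Rightarrow> nat \<Rightarrow> 'a set" where
  "fixed i j = {x \<in> carrier G. \<tau> i j x = x}"

text \<open>Distinctness of the concatenated list says that all \<open>2 * m\<close> points differ,
  so the transpositions are nontrivial and pairwise disjoint.\<close>

definition kills :: "nat \<Rightarrow> 'a set \<Rightarrow> nat set \<Rightarrow> bool" where
  "kills m A P \<longleftrightarrow> (\<forall>ps. length ps = m \<longrightarrow> distinct (map fst ps @ map snd ps) \<longrightarrow>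
     set (map fst ps @ map snd ps) \<subseteq> P \<longrightarrow> (\<forall>x\<in>A. iter_diff ps x = \<one>))"

lemma action_group_hom:
  assumes "i \<in> N" "j \<in> N"
  shows "group_hom G G (\<tau> i j)"
  by (rule group_hom.intro[OF is_group is_group]) (simp add: group_hom_axioms_def action_hom assms)

lemma action_closed [simp]: "\<lbrakk>i \<in> N; j \<in> N; x \<in> carrier G\<rbrakk> \<Longrightarrow> \<tau> i j x \<in> carrier G"
  using action_hom by (auto simp: hom_def)

lemma diff_closed [simp]: "\<lbrakk>i \<in> N; j \<in> N; x \<in> carrier G\<rbrakk> \<Longrightarrow> diff i j x \<in> carrier G"
  by (simp add: diff_def)

lemma diff_group_hom:
  assumes "i \<in> N" "j \<in> N"
  shows "group_hom G G (diff i j)"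
proof -
  interpret \<tau>: group_hom G G "\<tau> i j"
    using assms by (rule action_group_hom)
  show ?thesis
    by (rule group_hom.intro[OF is_group is_group])
      (auto simp: group_hom_axioms_def hom_def diff_def inv_mult m_ac)
qed

lemma iter_diff_group_hom:
  assumes "set (map fst ps @ map snd ps) \<subseteq> N"
  shows "group_hom G G (iter_diff ps)"
  using assms
proof (induction ps)
  case Nil
  show ?case
    by (rule group_hom.intro[OF is_group is_group]) (simp add: group_hom_axioms_def hom_def)
next
  case (Cons p ps)
  interpret d: group_hom G G "diff (fst p) (snd p)"
    using Cons.prems by (intro diff_group_hom) auto
  interpret ds: group_hom G G "iter_diff ps"
    using Cons by auto
  show ?case
    by (rule group_hom.intro[OF is_group is_group]) (simp add: group_hom_axioms_def hom_def)
qed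

lemma diff_eq_one_iff:
  assumes "i \<in> N" "j \<in> N" "x \<in> carrier G"
  shows "diff i j x = \<one> \<longleftrightarrow> x \<in> fixed i j"
proof
  assume "diff i j x = \<one>"
  then have "\<tau> i j x = x"
    using assms inv_equality[of x "inv (\<tau> i j x)"] by (simp add: diff_def)
  then show "x \<in> fixed i j"
    using assms by (simp add: fixed_def)
qed (use assms in \<open>simp add: diff_def fixed_def\<close>)

lemma fixed_subgroup:
  assumes "i \<in> N" "j \<in> N"
  shows "subgroup (fixed i j) G"
proof -
  interpret \<tau>: group_hom G G "\<tau> i j"
    using assms by (rule action_group_hom)
  show ?thesis
    by (rule subgroup.intro) (auto simp: fixed_def)
qed

lemma diff_fixed:
  assumes "i \<in> N" "j \<in> N" "k \<in> N" "l \<in> N" "i \<noteq> k" "i \<noteq> l" "j \<noteq> k" "j \<noteq> l" "x \<in> fixed i j"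
  shows "diff k l x \<in> fixed i j"
proof -
  interpret \<tau>: group_hom G G "\<tau> i j"
    using assms(1,2) by (rule action_group_hom)
  show ?thesis
    using assms action_commute[OF assms(1-8), of x] by (auto simp: fixed_def diff_def)
qed

text \<open>The differences applied before \<open>(i, j)\<close> belong to disjoint transpositions
  and keep the element fixed; the difference of \<open>(i, j)\<close> then sends it to
  \<open>\<one>\<close>.\<close>

lemma iter_diff_eq_one:
  assumes "distinct (map fst ps @ map snd ps)" "set (map fst ps @ map snd ps) \<subseteq> N"
    and "(i, j) \<in> set ps" "x \<in> fixed i j"
  shows "iter_diff ps x = \<one>"
  using assms
proof (induction ps arbitrary: x)
  case Nil
  then show ?case by simp
next
  case (Cons p ps)
  interpret ds: group_hom G G "iter_diff ps"
    using Cons.prems by (intro iter_diff_group_hom) auto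
  obtain k l where p: "p = (k, l)"
    by fastforce
  have x: "x \<in> carrier G"
    using Cons.prems by (simp add: fixed_def)
  show ?case
  proof (cases "p = (i, j)")
    case True
    then show ?thesis
      using Cons.prems x diff_eq_one_iff[of i j x] by simp
  next
    case False
    then have ij: "(i, j) \<in> set ps"
      using Cons.prems by auto
    then have "i \<in> fst ` set ps" "j \<in> snd ` set ps"
      by force+
    then have "diff k l x \<in> fixed i j"
      using Cons.prems p by (intro diff_fixed) auto
    then show ?thesis
      using Cons p ij by simp
  qed
qed

end

section \<open>Equivariant families of subgroups\<close>

text \<open>\<open>V T\<close> stands for the copy of \<open>V_T\<close> in one large module. The
  set \<open>P\<close> of admissible points is kept apart from \<open>N\<close> because a derived
  family gives up two points while the group and its action stay the same.\<close>

locale subgroup_family = transposition_action G \<tau> N for G (structure) and \<tau> N +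
  fixes P :: "nat set" and d :: nat and V :: "nat set \<Rightarrow> 'a set"
  assumes ground: "P \<subseteq> N" "finite P"
    and sub: "T \<subseteq> P \<Longrightarrow> subgroup (V T) G"
    and mono: "\<lbrakk>S \<subseteq> T; T \<subseteq> P\<rbrakk> \<Longrightarrow> V S \<subseteq> V T"
    and action: "\<lbrakk>T \<subseteq> P; i \<in> P; j \<in> P; x \<in> V T\<rbrakk> \<Longrightarrow> \<tau> i j x \<in> V (Transposition.transpose i j ` T)"
    and action_trivial: "\<lbrakk>T \<subseteq> P; i \<in> P - T; j \<in> P - T; x \<in> V T\<rbrakk> \<Longrightarrow> \<tau> i j x = x"
    and generated: "T \<subseteq> P \<Longrightarrow> V T \<subseteq> generate G (\<Union>{V S | S. S \<subseteq> T \<and> card S \<le> d})"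
begin

lemma mem_carrier: "\<lbrakk>T \<subseteq> P; x \<in> V T\<rbrakk> \<Longrightarrow> x \<in> carrier G"
  using subgroup.mem_carrier[OF sub] .

lemma Union_carrier: "T \<subseteq> P \<Longrightarrow> (\<Union>i\<in>A. V (T - {i})) \<subseteq> carrier G"
  using mem_carrier by blast

lemma trivial_fixed: "\<lbrakk>T \<subseteq> P; i \<in> P - T; j \<in> P - T\<rbrakk> \<Longrightarrow> V T \<subseteq> fixed i j"
  using action_trivial mem_carrier by (auto simp: fixed_def)

lemma iter_diff_mem:
  assumes "T \<subseteq> P" "x \<in> V T" "set (map fst ps @ map snd ps) \<subseteq> T"
  shows "iter_diff ps x \<in> V T"
  using assms(2,3)
proof (induction ps arbitrary: x)
  case (Cons p ps)
  have "\<tau> (fst p) (snd p) x \<in> V (Transposition.transpose (fst p) (snd p) ` T)"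
    using Cons.prems assms(1) by (intro action) auto
  also have "Transposition.transpose (fst p) (snd p) ` T = T"
    using Cons.prems by (intro transpose_image_eq) auto
  finally have "diff (fst p) (snd p) x \<in> V T"
    using Cons.prems sub[OF assms(1)]
    by (simp add: diff_def subgroup.m_closed subgroup.m_inv_closed)
  then show ?case
    using Cons by simp
qed simp

text \<open>Replacing \<open>x\<close> by \<open>diff i j x\<close> changes it by
  \<open>\<tau> i j x\<close>, which lives over a subset of \<open>T\<close> that has lost
  \<open>i\<close>. The other pairs avoid \<open>i\<close>, so their differences keep this error in
  \<open>V (T - {i})\<close>.\<close>

lemma iter_diff_congruent:
  assumes "T \<subseteq> P" "S \<subseteq> T" "x \<in> V S" "distinct (map fst ps @ map snd ps)"
    and "fst ` set ps \<subseteq> A \<inter> S" "snd ` set ps \<subseteq> T - S"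
  shows "x \<otimes> inv (iter_diff ps x) \<in> generate G (\<Union>i\<in>A. V (T - {i}))"
  using assms(4-6)
proof (induction ps)
  case Nil
  then show ?case
    using mem_carrier[of S x] assms(1-3) by (auto simp: generate.one)
next
  case (Cons p ps)
  obtain i j where p: "p = (i, j)"
    by fastforce
  let ?R = "generate G (\<Union>i\<in>A. V (T - {i}))"
  have "fst ` set ps \<subseteq> N" "snd ` set ps \<subseteq> N"
  proof -
    have "fst ` set ps \<subseteq> S" "snd ` set ps \<subseteq> T"
      using Cons.prems(2,3) by auto
    then show "fst ` set ps \<subseteq> N" "snd ` set ps \<subseteq> N"
      using assms(1,2) ground(1) by blast+
  qed
  then interpret ds: group_hom G G "iter_diff ps"
    by (intro iter_diff_group_hom) simp
  have x: "x \<in> carrier G"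
    using mem_carrier[of S x] assms(1-3) by auto
  have ij: "i \<in> A" "i \<in> S" "j \<in> T" "j \<notin> S" "i \<in> N" "j \<in> N" "i \<in> P" "j \<in> P"
    using Cons.prems p assms ground by auto
  have "\<tau> i j x \<in> V (Transposition.transpose i j ` S)"
    using assms ij by (intro action) auto
  moreover have "Transposition.transpose i j ` S \<subseteq> T - {i}"
    using assms(2) ij by (auto simp: Transposition.transpose_def)
  ultimately have "\<tau> i j x \<in> V (T - {i})"
    using mono[of "Transposition.transpose i j ` S" "T - {i}"] assms(1) by blast
  then have "iter_diff ps (\<tau> i j x) \<in> V (T - {i})"
    using Cons.prems p assms(1,2) by (intro iter_diff_mem) auto
  then have "iter_diff ps (\<tau> i j x) \<in> ?R"
    using ij by (auto intro: generate.incl)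
  moreover have "x \<otimes> inv (iter_diff ps x) \<in> ?R"
    using Cons by auto
  ultimately have "x \<otimes> inv (iter_diff ps x) \<otimes> iter_diff ps (\<tau> i j x) \<in> ?R"
    by (rule generate.eng[rotated])
  \<comment> \<open>By the homomorphism property, \<open>iter_diff (p # ps) x\<close> is the
    quotient of \<open>iter_diff ps x\<close> by \<open>iter_diff ps (\<tau> i j x)\<close>.\<close>
  moreover have "x \<otimes> inv (iter_diff ps x) \<otimes> iter_diff ps (\<tau> i j x) = x \<otimes> inv (iter_diff (p # ps) x)"
    using x ij by (simp add: p diff_def inv_mult m_ac)
  ultimately show ?case
    by simp
qed

lemma kills_generating_degree: "kills (Suc d) (V P) P"
  unfolding kills_def
proof (intro allI impI)
  fix ps :: "(nat \<times> nat) list"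
  assume len: "length ps = Suc d" and dist: "distinct (map fst ps @ map snd ps)"
    and ps: "set (map fst ps @ map snd ps) \<subseteq> P"
  interpret ds: group_hom G G "iter_diff ps"
    using ps ground by (intro iter_diff_group_hom) auto
  have "iter_diff ps x = \<one>" if S: "S \<subseteq> P" "card S \<le> d" and x: "x \<in> V S" for S x
  proof -
    have "\<exists>p\<in>set ps. fst p \<notin> S \<and> snd p \<notin> S"
    proof (rule ccontr)
      assume none: "\<not> ?thesis"
      \<comment> \<open>If \<open>S\<close> met every pair, choosing a point of \<open>S\<close>
        from each would embed \<open>Suc d\<close> pairs into \<open>S\<close>; the choice is
        injective because the pairs are disjoint.\<close>
      let ?f = "\<lambda>p. if fst p \<in> S then fst p else snd p"
      have "inj_on ?f (set ps)"
      proof (rule inj_onI)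
        fix p q assume pq: "p \<in> set ps" "q \<in> set ps" "?f p = ?f q"
        have "inj_on fst (set ps)" "inj_on snd (set ps)" "fst ` set ps \<inter> snd ` set ps = {}"
          using dist by (auto simp: distinct_map)
        then show "p = q"
          using pq by (auto split: if_splits dest: inj_onD)
      qed
      moreover have "?f ` set ps \<subseteq> S"
        using none by auto
      ultimately have "card (set ps) \<le> card S"
        using finite_subset[OF S(1) ground(2)] by (rule card_inj_on_le)
      moreover have "card (set ps) = Suc d"
        using dist len distinct_card[of ps] by (simp add: distinct_map)
      ultimately show False
        using S by simp
    qed
    then obtain i j where ij: "(i, j) \<in> set ps" "i \<notin> S" "j \<notin> S"
      by auto
    then have "i \<in> P" "j \<in> P"
      using ps by force+
    then have "x \<in> fixed i j"
      using trivial_fixed[of S i j] S x ij by auto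
    then show ?thesis
      using iter_diff_eq_one[OF dist order.trans[OF ps ground(1)] ij(1)] by blast
  qed
  \<comment> \<open>A kernel is a subgroup, so vanishing on generators suffices.\<close>
  then have "V P \<subseteq> kernel G G (iter_diff ps)"
    using mem_carrier
    by (intro order.trans[OF generated[OF subset_refl]] generate_subgroup_incl ds.subgroup_kernel)
      (auto simp: kernel_def)
  then show "\<forall>x\<in>V P. iter_diff ps x = \<one>"
    by (auto simp: kernel_def)
qed

text \<open>
  If \<open>S \<supseteq> A\<close>, moving \<open>m + 1\<close> points of \<open>A\<close> out of \<open>S\<close> expresses \<open>V S\<close> through the subgroups
  \<open>V (T - {i})\<close>, because the alternating sum over all these moves vanishes.
\<close>

lemma generated_by_deletions:
  assumes "kills (Suc m) (V P) P" "T \<subseteq> P" "card T > m + d" "A \<subseteq> T" "card A > m"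
  shows "V T \<subseteq> generate G (\<Union>i\<in>A. V (T - {i}))"
proof (rule order.trans[OF generated[OF assms(2)]], rule generate_subgroup_incl)
  let ?R = "generate G (\<Union>i\<in>A. V (T - {i}))"
  show "subgroup ?R G"
    using assms(2) by (intro generate_is_subgroup Union_carrier)
  have fin: "finite T"
    using assms(2) ground finite_subset by blast
  have "x \<in> ?R" if S: "S \<subseteq> T" "card S \<le> d" and x: "x \<in> V S" for S x
  proof (cases "A \<subseteq> S")
    case False
    then obtain i where i: "i \<in> A" "i \<notin> S"
      by blast
    then have "V S \<subseteq> V (T - {i})"
      using S assms by (intro mono) auto
    then show ?thesis
      using i x by (auto intro: generate.incl)
  next
    case True
    \<comment> \<open>\<open>card T > m + d\<close> and \<open>card S \<le> d\<close> leave
      \<open>m + 1\<close> free points of \<open>T\<close> as targets for the moves.\<close>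
    have "card (T - S) \<ge> Suc m"
      using S assms(3) fin by (simp add: card_Diff_subset finite_subset)
    then obtain B where B: "B \<subseteq> T - S" "card B = Suc m"
      by (meson obtain_subset_with_card_n)
    obtain A' where A': "A' \<subseteq> A" "card A' = Suc m"
      using assms(5) by (metis Suc_leI obtain_subset_with_card_n)
    have "finite A'" "finite B"
      using A' B by (metis card.infinite nat.distinct(1))+
    then obtain as bs where abs: "set as = A'" "distinct as" "set bs = B" "distinct bs"
      using finite_distinct_list by metis
    then have len: "length as = Suc m" "length bs = Suc m"
      using A' B distinct_card by metis+
    let ?ps = "zip as bs"
    have maps: "map fst ?ps = as" "map snd ?ps = bs"
      using len by simp_all
    have sets: "fst ` set ?ps = A'" "snd ` set ?ps = B"
      using maps abs by (metis list.set_map)+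
    have dist: "distinct (map fst ?ps @ map snd ?ps)"
      using abs A' B True unfolding maps by auto
    have "x \<in> V P"
      using mono[of S P] S x assms(2) by auto
    moreover have "set (map fst ?ps @ map snd ?ps) \<subseteq> P"
      using abs A' B assms unfolding maps by auto
    ultimately have "iter_diff ?ps x = \<one>"
      using assms(1) dist len unfolding kills_def by (metis length_zip min.idem)
    moreover have "x \<otimes> inv (iter_diff ?ps x) \<in> ?R"
      using S x dist A' B True assms(2) by (intro iter_diff_congruent) (auto simp: sets)
    ultimately show ?thesis
      using mem_carrier[of S x] S x assms(2) by simp
  qed
  then show "\<Union>{V S | S. S \<subseteq> T \<and> card S \<le> d} \<subseteq> ?R"
    by blast
qed

text \<open>Generators over sets without \<open>b\<close> also avoid \<open>c\<close>; they are
  fixed by \<open>(b c)\<close> and vanish under \<open>diff b c\<close>. In the others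
  \<open>b\<close> no longer counts, so the degree drops. For \<open>d = 0\<close> only vanishing
  generators occur, which makes the truncated \<open>d - 1\<close> harmless. Both points leave the
  ground set so that the remaining transpositions commute with \<open>(b c)\<close>.\<close>

lemma derived_family:
  assumes b: "b \<in> P" "c \<in> P" "b \<noteq> c"
  shows "subgroup_family G \<tau> N (P - {b, c}) (d - 1) (\<lambda>T. diff b c ` V (insert b T))"
proof (rule subgroup_family.intro[OF transposition_action_axioms subgroup_family_axioms.intro])
  have N: "b \<in> N" "c \<in> N"
    using b ground by auto
  interpret D: group_hom G G "diff b c"
    using N by (rule diff_group_hom)
  show "P - {b, c} \<subseteq> N" "finite (P - {b, c})"
    using ground by auto
  show "subgroup (diff b c ` V (insert b T)) G" if "T \<subseteq> P - {b, c}" for T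
    using that b by (intro D.subgroup_img_is_subgroup sub) auto
  show "diff b c ` V (insert b S) \<subseteq> diff b c ` V (insert b T)" if "S \<subseteq> T" "T \<subseteq> P - {b, c}" for S T
    using that b by (intro image_mono mono) auto
  have comm: "\<tau> i j (diff b c y) = diff b c (\<tau> i j y)"
    if ij: "i \<in> P - {b, c}" "j \<in> P - {b, c}" and y: "y \<in> carrier G" for i j y
  proof -
    interpret \<tau>: group_hom G G "\<tau> i j"
      using ij ground by (intro action_group_hom) auto
    have "\<tau> i j (\<tau> b c y) = \<tau> b c (\<tau> i j y)"
      using ij N y ground by (intro action_commute) auto
    then show ?thesis
      using y N by (simp add: diff_def)
  qed
  show "\<tau> i j x \<in> diff b c ` V (insert b (Transposition.transpose i j ` T))"
    if "T \<subseteq> P - {b, c}" "i \<in> P - {b, c}" "j \<in> P - {b, c}" and x: "x \<in> diff b c ` V (insert b T)" for T i j x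
  proof -
    obtain y where y: "y \<in> V (insert b T)" "x = diff b c y"
      using x by auto
    have T: "insert b T \<subseteq> P"
      using that b by auto
    have "\<tau> i j y \<in> V (Transposition.transpose i j ` insert b T)"
      using that T y by (intro action) auto
    also have "Transposition.transpose i j ` insert b T = insert b (Transposition.transpose i j ` T)"
      using that by auto
    finally show ?thesis
      using comm[of i j y] mem_carrier[OF T y(1)] that y by auto
  qed
  show "\<tau> i j x = x"
    if "T \<subseteq> P - {b, c}" "i \<in> P - {b, c} - T" "j \<in> P - {b, c} - T" and x: "x \<in> diff b c ` V (insert b T)" for T i j x
  proof -
    obtain y where y: "y \<in> V (insert b T)" "x = diff b c y"
      using x by auto
    have T: "insert b T \<subseteq> P"
      using that b by auto
    show ?thesis
      using comm[of i j y] mem_carrier[OF T y(1)] action_trivial[OF T _ _ y(1), of i j] that y by auto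
  qed
  show "diff b c ` V (insert b T)
      \<subseteq> generate G (\<Union>{diff b c ` V (insert b S) | S. S \<subseteq> T \<and> card S \<le> d - 1})" (is "_ \<subseteq> ?R")
    if T: "T \<subseteq> P - {b, c}" for T
  proof -
    have T': "insert b T \<subseteq> P"
      using T b by auto
    let ?U = "\<Union>{V S | S. S \<subseteq> insert b T \<and> card S \<le> d}"
    have "V S \<subseteq> carrier G" if "S \<subseteq> insert b T" for S
      using that T' by (intro subsetI mem_carrier[of S]) auto
    then have U: "?U \<subseteq> carrier G"
      by auto
    have "diff b c x \<in> ?R" if S: "S \<subseteq> insert b T" "card S \<le> d" and x: "x \<in> V S" for S x
    proof (cases "b \<in> S")
      case True
      then have "S = insert b (S - {b})" "S - {b} \<subseteq> T" "card (S - {b}) \<le> d - 1"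
        using S by auto
      then have "diff b c x \<in> diff b c ` V (insert b (S - {b}))"
        using x by auto
      then show ?thesis
        using \<open>S - {b} \<subseteq> T\<close> \<open>card (S - {b}) \<le> d - 1\<close> by (blast intro: generate.incl)
    next
      case False
      then have "x \<in> fixed b c"
        using trivial_fixed[of S b c] S x T b by auto
      then show ?thesis
        using diff_eq_one_iff[OF N, of x] generate.one[of G] by (simp add: fixed_def)
    qed
    then have "diff b c ` ?U \<subseteq> ?R"
      by auto
    moreover have "subgroup ?R G"
    proof (rule generate_is_subgroup, safe)
      fix S x assume "S \<subseteq> T" "x \<in> V (insert b S)"
      moreover from this have "insert b S \<subseteq> P"
        using T b by auto
      ultimately show "diff b c x \<in> carrier G"
        using mem_carrier N by (blast intro: diff_closed)
    qed
    ultimately have "generate G (diff b c ` ?U) \<subseteq> ?R"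
      by (rule generate_subgroup_incl)
    moreover have "diff b c ` V (insert b T) \<subseteq> generate G (diff b c ` ?U)"
      using generated[OF T'] D.generate_img[OF U] by auto
    ultimately show ?thesis
      by blast
  qed
qed

text \<open>Prepending \<open>(b, c)\<close> turns a product of \<open>m\<close> differences away
  from \<open>b\<close> and \<open>c\<close> into one of \<open>m + 1\<close> differences.\<close>

lemma kills_derived_family:
  assumes b: "b \<in> P" "c \<in> P" "b \<noteq> c" and "kills (Suc m) (V P) P"
  shows "kills m (diff b c ` V (insert b (P - {b, c}))) (P - {b, c})"
  unfolding kills_def
proof (intro allI impI ballI)
  fix ps x
  assume ps: "length ps = m" "distinct (map fst ps @ map snd ps)"
    "set (map fst ps @ map snd ps) \<subseteq> P - {b, c}" and "x \<in> diff b c ` V (insert b (P - {b, c}))"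
  then obtain y where y: "y \<in> V (insert b (P - {b, c}))" "x = diff b c y"
    by auto
  have "y \<in> V P"
    using mono[of "insert b (P - {b, c})" P] b y by auto
  moreover have "distinct (map fst ((b, c) # ps) @ map snd ((b, c) # ps))"
    "set (map fst ((b, c) # ps) @ map snd ((b, c) # ps)) \<subseteq> P" "length ((b, c) # ps) = Suc m"
    using ps b by auto
  ultimately have "iter_diff ((b, c) # ps) y = \<one>"
    using assms(4) unfolding kills_def by blast
  then show "iter_diff ps x = \<one>"
    using y by simp
qed

end

section \<open>The double induction on the number of differences and the set of deleted
  points\<close>

text \<open>
  The condition \<open>x \<in> fixed i (s i)\<close>, with \<open>s i\<close> a point outside \<open>T\<close>, stands in for \<open>x \<in> M (T - {i})\<close>.
  Unlike the latter it survives the passage from \<open>T\<close> to \<open>T - {c}\<close> and to the derived family.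
\<close>

lemma sum_of_fixed_mem:
  fixes G (structure)
  assumes "subgroup_family G \<tau> N P d V"
    and "transposition_action.kills G \<tau> (Suc m) (V P) P" and "m \<le> d"
    and "T \<subseteq> P" "s ` T \<subseteq> P" "inj_on s T" "T \<inter> s ` T = {}" "card T > m + d" "A \<subseteq> T"
    and "v \<in> V T" "v \<in> generate G (\<Union>i\<in>A. transposition_action.fixed G \<tau> i (s i))"
  shows "v \<in> generate G (\<Union>i\<in>A. V (T - {i}))"
  using assms
proof (induction m arbitrary: P d V T A v rule: less_induct)
  case outer: (less m)
  interpret subgroup_family G \<tau> N P d V
    by fact
  note kills = outer.prems(2) and md = outer.prems(3) and T = outer.prems(4-8)
  have finT: "finite T"
    using T(1) ground finite_subset by blast
  let ?F = "\<lambda>A. \<Union>i\<in>A. fixed i (s i)" and ?R = "\<lambda>A. \<Union>i\<in>A. V (T - {i})"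
  have s: "i \<in> N" "s i \<in> N" "i \<in> P" "s i \<in> P" "s i \<notin> T" if "i \<in> T" for i
    using that T ground by auto
  have F: "subgroup (generate G (?F A)) G" if "A \<subseteq> T" for A
    by (rule generate_is_subgroup) (auto simp: fixed_def)
  have R: "subgroup (generate G (?R A)) G" for A
    using T by (intro generate_is_subgroup Union_carrier)
  \<comment> \<open>Both \<open>i\<close> and \<open>s i\<close> lie outside \<open>T - {i}\<close>,
    so their transposition acts trivially on \<open>V (T - {i})\<close>.\<close>
  have RF: "generate G (?R A) \<subseteq> generate G (?F A)" if "A \<subseteq> T" for A
  proof (rule mono_generate, rule UN_mono[OF subset_refl])
    fix i assume "i \<in> A"
    then show "V (T - {i}) \<subseteq> fixed i (s i)"
      using that s[of i] T by (intro trivial_fixed) auto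
  qed
  show ?case
    using outer.prems(9-11)
  \<comment> \<open>The measure falls as \<open>A\<close> grows and is zero once
    \<open>card A > m\<close>.\<close>
  proof (induction "Suc m - card A" arbitrary: A v rule: less_induct)
    case inner: less
    show ?case
    proof (cases "card A > m \<or> A = {}")
      \<comment> \<open>A large \<open>A\<close> is settled by
        \<open>generated_by_deletions\<close>; for empty \<open>A\<close>, hypothesis and claim both
        concern the trivial subgroup.\<close>
      case True
      then show ?thesis
        using generated_by_deletions[OF kills T(1,5) inner.prems(1)] inner.prems by auto
    next
      case False
      then obtain b where b: "b \<in> A" and m: "m > 0" "card A \<le> m"
        using finite_subset[OF inner.prems(1) finT] by (metis card_gt_0_iff equals0I leI less_le_trans)
      have "card A < card T"
        using m T(5) by simp
      then obtain c where c: "c \<in> T" "c \<notin> A"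
        using inner.prems(1) by (metis less_irrefl subsetI subset_antisym)
      have bT: "b \<in> T" and bc: "b \<noteq> c"
        using b c inner.prems(1) by auto
      note sb = s[OF bT]
      \<comment> \<open>Enlarging \<open>A\<close> by \<open>c\<close> weakens the condition on
        \<open>v\<close>, so the inner hypothesis applies; the surplus summand
        \<open>V (T - {c})\<close> is then split off as \<open>w\<close>.\<close>
      have "v \<in> generate G (?R (insert c A))"
      proof (rule inner.hyps)
        show "Suc m - card (insert c A) < Suc m - card A"
          using c m finite_subset[OF inner.prems(1) finT] by simp
        show "v \<in> generate G (?F (insert c A))"
          using inner.prems(3) mono_generate[of "?F A" "?F (insert c A)"] by auto
      qed (use c inner.prems in auto)
      also have "\<dots> \<subseteq> generate G (?R A) <#> V (T - {c})"
        using generate_Un_subgroups[of "?R A" "V (T - {c})"] Union_carrier[OF T(1)] sub[of "T - {c}"] T(1)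
        by (auto simp: Un_commute)
      finally obtain u w where u: "u \<in> generate G (?R A)" and w: "w \<in> V (T - {c})" and v: "v = u \<otimes> w"
        by (auto simp: set_mult_def)
      have car: "u \<in> carrier G" "w \<in> carrier G"
        using subgroup.mem_carrier[OF R u] mem_carrier[of "T - {c}" w] w T(1) by auto
      have "w = inv u \<otimes> v"
        using car v by (simp add: m_assoc[symmetric])
      \<comment> \<open>The condition for \<open>A\<close> passes from \<open>v\<close> to
        \<open>w\<close>, since \<open>u\<close> satisfies it by \<open>RF\<close>.\<close>
      then have wF: "w \<in> generate G (?F A)"
        using F[OF inner.prems(1)] u RF[OF inner.prems(1)] inner.prems(3)
        by (auto intro!: subgroup.m_closed subgroup.m_inv_closed)

      \<comment> \<open>The outside point is \<open>s b\<close>. Dropping \<open>c\<close> from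
        \<open>T\<close> as well makes \<open>?V ?T\<close> the image of \<open>V (T - {c})\<close>,
        which contains \<open>w\<close>.\<close>
      let ?P = "P - {b, s b}" and ?V = "\<lambda>T. diff b (s b) ` V (insert b T)"
        and ?T = "T - {b, c}" and ?A = "A - {b}"
      interpret D: group_hom G G "diff b (s b)"
        using sb by (intro diff_group_hom)
      have bs: "b \<noteq> s b"
        using bT sb by auto
      interpret V': subgroup_family G \<tau> N ?P "d - 1" ?V
        using sb bs by (intro derived_family)
      have insT: "insert b ?T = T - {c}"
        using bT bc by auto
      have "diff b (s b) w \<in> generate G (\<Union>i\<in>?A. ?V (?T - {i}))"
      proof (rule outer.IH[of "m - 1"])
        show "m - 1 < m"
          using m by simp
        show "subgroup_family G \<tau> N ?P (d - 1) ?V"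
          by (rule V'.subgroup_family_axioms)
        show "kills (Suc (m - 1)) (?V ?P) ?P"
          using kills_derived_family[of b "s b" m] kills sb bs m by simp
        show "m - 1 \<le> d - 1"
          using md by simp
        show "?T \<subseteq> ?P" "?T \<inter> s ` ?T = {}" "?A \<subseteq> ?T" "inj_on s ?T"
          using T sb inner.prems(1) c by (auto intro: inj_on_subset)
        show "s ` ?T \<subseteq> ?P"
          using T bT by (auto dest: inj_onD)
        \<comment> \<open>By \<open>0 < m \<le> d\<close> both subtractions are genuine: the bound
          falls by two, just as the cardinality does.\<close>
        show "m - 1 + (d - 1) < card ?T"
          using T(5) bT c bc m md finT by (simp add: card_Diff_subset)
        show "diff b (s b) w \<in> ?V ?T"
          using w by (simp only: insT) blast
        \<comment> \<open>The summand of \<open>b\<close> vanishes under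
          \<open>diff b (s b)\<close>; the others are preserved, because neither \<open>i\<close>
          nor \<open>s i\<close> equals \<open>b\<close> or \<open>s b\<close>.\<close>
        have "diff b (s b) ` ?F A \<subseteq> generate G (?F ?A)"
        proof safe
          fix i x assume i: "i \<in> A" and x: "x \<in> fixed i (s i)"
          show "diff b (s b) x \<in> generate G (?F ?A)"
          proof (cases "i = b")
            case True
            then show ?thesis
              using x diff_eq_one_iff[of b "s b" x] sb generate.one[of G] by (simp add: fixed_def)
          next
            case False
            have iT: "i \<in> T"
              using i inner.prems(1) by auto
            have "diff b (s b) x \<in> fixed i (s i)"
              using False iT bT T(3) s[OF iT] sb x
              by (intro diff_fixed) (auto dest: inj_onD)
            then show ?thesis
              using i False by (auto intro: generate.incl)
          qed
        qed
        then have "generate G (diff b (s b) ` ?F A) \<subseteq> generate G (?F ?A)"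
          by (rule generate_subgroup_incl) (rule F, use inner.prems(1) in auto)
        moreover have "diff b (s b) ` generate G (?F A) = generate G (diff b (s b) ` ?F A)"
          by (rule D.generate_img[symmetric]) (auto simp: fixed_def)
        ultimately show "diff b (s b) w \<in> generate G (?F ?A)"
          using wF by blast
      qed
      \<comment> \<open>The sum in the derived family is the image of a sum in \<open>V\<close>;
        this lifts the outer hypothesis to some \<open>w'\<close> with the same difference as
        \<open>w\<close>.\<close>
      also have "(\<Union>i\<in>?A. ?V (?T - {i})) = diff b (s b) ` (\<Union>i\<in>?A. V (T - {c} - {i}))"
      proof -
        have "insert b (?T - {i}) = T - {c} - {i}" if "i \<in> ?A" for i
          using that bT bc by auto
        then show ?thesis
          by (simp add: image_UN)
      qed
      also have "generate G (diff b (s b) ` (\<Union>i\<in>?A. V (T - {c} - {i})))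
          = diff b (s b) ` generate G (\<Union>i\<in>?A. V (T - {c} - {i}))"
        using T(1) by (intro D.generate_img Union_carrier) auto
      finally obtain w' where w': "w' \<in> generate G (\<Union>i\<in>?A. V (T - {c} - {i}))"
        and eq: "diff b (s b) w = diff b (s b) w'"
        by blast
      have w'V: "w' \<in> V (T - {c})"
      proof -
        have "generate G (\<Union>i\<in>?A. V (T - {c} - {i})) \<subseteq> V (T - {c})"
        proof (rule generate_subgroup_incl)
          show "(\<Union>i\<in>?A. V (T - {c} - {i})) \<subseteq> V (T - {c})"
            using T(1) by (intro UN_least mono) auto
          show "subgroup (V (T - {c})) G"
            using T(1) by (intro sub) auto
        qed
        then show ?thesis
          using w' by blast
      qed
      have w'R: "w' \<in> generate G (?R A)"
      proof -
        have "(\<Union>i\<in>?A. V (T - {c} - {i})) \<subseteq> ?R A"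
          using T(1) by (intro UN_mono mono) auto
        then show ?thesis
          using w' mono_generate by blast
      qed
      have w'car: "w' \<in> carrier G"
        using w'V mem_carrier[of "T - {c}" w'] T(1) by auto
      define x where "x = w \<otimes> inv w'"
      have xcar: "x \<in> carrier G"
        using car w'car by (simp add: x_def)
      have xV: "x \<in> V (T - {c})"
        unfolding x_def using w w'V sub[of "T - {c}"] T(1)
        by (auto intro!: subgroup.m_closed subgroup.m_inv_closed)
      have "diff b (s b) x = \<one>"
        using car w'car eq by (simp add: x_def)
      then have "\<tau> b (s b) x = x"
        using diff_eq_one_iff[of b "s b" x] xcar sb by (simp add: fixed_def)
      then have "x \<in> V (Transposition.transpose b (s b) ` (T - {c}))"
        using action[of "T - {c}" b "s b" x] xV sb T(1) by auto
      \<comment> \<open>The first transposition replaced \<open>b\<close> by \<open>s b\<close>, and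
        this one puts \<open>c\<close> in the place of \<open>s b\<close>: \<open>T - {c}\<close>
        has become \<open>T - {b}\<close>. It also fixes \<open>x\<close>, because
        \<open>s b\<close> and \<open>c\<close> lie outside \<open>T - {c}\<close>.\<close>
      then have "\<tau> (s b) c x \<in> V (Transposition.transpose (s b) c ` Transposition.transpose b (s b) ` (T - {c}))"
        using T(1) sb s[OF c(1)] by (intro action) (auto simp: Transposition.transpose_def)
      also have "Transposition.transpose (s b) c ` Transposition.transpose b (s b) ` (T - {c}) \<subseteq> T - {b}"
        using bc bs sb c(1) by (auto simp: Transposition.transpose_def)
      then have "V (Transposition.transpose (s b) c ` Transposition.transpose b (s b) ` (T - {c})) \<subseteq> V (T - {b})"
        using T(1) by (intro mono) auto
      also have "\<tau> (s b) c x = x"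
        using T(1) sb s[OF c(1)] xV by (intro action_trivial[of "T - {c}"]) auto
      finally have "x \<in> generate G (?R A)"
        using b by (auto intro: generate.incl)
      moreover have "w = x \<otimes> w'"
        using car w'car by (simp add: x_def m_assoc)
      ultimately show ?thesis
        using u w'R v by (auto intro: generate.eng)
    qed
  qed
qed

section \<open>From FI-modules to families of subgroups\<close>

lemma restrict_transpose_hom:
  "restrict (Transposition.transpose i j) T \<in> FI_hom T (Transposition.transpose i j ` T)"
  by (auto simp: FI_hom_def inj_on_restrict_eq)

lemma restrict_transpose_hom_self:
  "\<lbrakk>i \<in> T; j \<in> T\<rbrakk> \<Longrightarrow> restrict (Transposition.transpose i j) T \<in> FI_hom T T"
  using restrict_transpose_hom[of i j T] by (simp add: transpose_image_eq)

text \<open>Reduces generation by arbitrary injections to generation by inclusions of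
  subsets.\<close>

lemma FI_hom_factor_image:
  assumes "f \<in> FI_hom S T"
  shows "f \<in> FI_hom S (f ` S)" "f ` S \<subseteq> T" "compose S (FI_incl (f ` S)) f = f"
  using assms by (auto simp: FI_hom_def compose_def FI_incl_def PiE_iff extensional_def fun_eq_iff)

context FI_module
begin

lemma map_closed:
  "\<lbrakk>finite S; finite T; f \<in> FI_hom S T; x \<in> carrier (fi_obj W S)\<rbrakk>
    \<Longrightarrow> fi_map W S T f x \<in> carrier (fi_obj W T)"
  using map_hom by (auto simp: hom_def)

lemma map_group_hom:
  assumes "finite S" "finite T" "f \<in> FI_hom S T"
  shows "group_hom (fi_obj W S) (fi_obj W T) (fi_map W S T f)"
  using assms comm_group_obj map_hom
  by (auto simp: group_hom_def group_hom_axioms_def comm_group.axioms(2))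

lemma map_incl_incl:
  assumes "S \<subseteq> T" "T \<subseteq> U" "finite U" "x \<in> carrier (fi_obj W S)"
  shows "fi_map W T U (FI_incl T) (fi_map W S T (FI_incl S) x) = fi_map W S U (FI_incl S) x"
proof -
  have "compose S (FI_incl T) (FI_incl S) = FI_incl S"
    using assms(1) by (auto simp: compose_def FI_incl_def fun_eq_iff)
  moreover have "finite T" "finite S"
    using assms by (auto intro: finite_subset)
  ultimately show ?thesis
    using map_compose[of S T U "FI_incl S" "FI_incl T" x] assms by (simp add: FI_incl_hom)
qed

lemma image_FI_image:
  assumes "S \<subseteq> T" "T \<subseteq> U" "finite U" "A \<subseteq> carrier (fi_obj W S)"
  shows "fi_map W T U (FI_incl T) ` FI_image W S T A = FI_image W S U A"
  unfolding FI_image_def image_image using assms(4)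
  by (intro image_cong refl map_incl_incl[OF assms(1-3)]) auto

lemma FI_image_carrier:
  assumes "S \<subseteq> T" "finite T" "A \<subseteq> carrier (fi_obj W S)"
  shows "FI_image W S T A \<subseteq> carrier (fi_obj W T)"
  unfolding FI_image_def using assms finite_subset[OF assms(1,2)]
  by (auto intro!: map_closed FI_incl_hom)

text \<open>The degree tests only the sets \<open>[n]\<close>; a bijection from
  \<open>{1..card T}\<close> onto \<open>T\<close> carries the result to every finite
  \<open>T\<close>.\<close>

lemma lower_span_eq_carrier:
  assumes "FI_generated_in_degree W m" "finite T" "card T > m"
  shows "FI_lower_span W T = carrier (fi_obj W T)"
proof
  show "FI_lower_span W T \<subseteq> carrier (fi_obj W T)"
    using lower_span_subgroup[OF assms(2)] subgroup.subset by blast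
  let ?I = "{1..card T}"
  have "FI_degree (FI_H0 W) < ereal (real (card T))"
    using assms(1,3) unfolding FI_generated_in_degree_def by (simp add: le_less_trans)
  then have "trivial_group (fi_obj (FI_H0 W) ?I)"
    \<comment> \<open>An infimum below \<open>card T\<close> has a member of the set below
      \<open>card T\<close>, whose defining property then applies at \<open>card T\<close>.\<close>
    unfolding FI_degree_def Inf_less_iff by auto
  then obtain z where z: "carrier (fi_obj W ?I Mod FI_lower_span W ?I) = {z}"
    by (auto simp: trivial_group_def FI_H0_def)
  interpret I: comm_group "fi_obj W ?I"
    by (rule comm_group_obj) simp
  have H: "subgroup (FI_lower_span W ?I) (fi_obj W ?I)"
    by (rule lower_span_subgroup) simp
  \<comment> \<open>In a one-element quotient every coset equals that of \<open>\<one>\<close>, the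
    lower span itself.\<close>
  have coset: "FI_lower_span W ?I #>\<^bsub>fi_obj W ?I\<^esub> y = z" if "y \<in> carrier (fi_obj W ?I)" for y
    using z that by (auto simp: carrier_FactGroup)
  have I: "y \<in> FI_lower_span W ?I" if "y \<in> carrier (fi_obj W ?I)" for y
    using I.rcos_self[OF that H] coset[OF that] coset[OF I.one_closed] I.coset_mult_one[of "FI_lower_span W ?I"]
      subgroup.subset[OF H] by simp
  obtain h where h: "bij_betw h ?I T"
    using ex_bij_betw_nat_finite_1[OF assms(2)] by blast
  let ?f = "restrict h ?I" and ?g = "restrict (the_inv_into ?I h) T"
  have hom: "?f \<in> FI_hom ?I T" "?g \<in> FI_hom T ?I"
    using h bij_betw_the_inv_into[OF h]
    by (auto simp: FI_hom_def bij_betw_def inj_on_restrict_eq simp del: atLeastAtMost_iff)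
  have fg: "compose T ?f ?g = FI_incl T"
  proof
    fix x
    have "the_inv_into ?I h x \<in> ?I" "h (the_inv_into ?I h x) = x" if "x \<in> T"
      using that h bij_betw_the_inv_into[OF h]
      by (auto simp: bij_betw_def f_the_inv_into_f)
    then show "compose T ?f ?g x = FI_incl T x"
      by (simp add: compose_def FI_incl_def)
  qed
  show "carrier (fi_obj W T) \<subseteq> FI_lower_span W T"
  proof
    fix x assume x: "x \<in> carrier (fi_obj W T)"
    then have "fi_map W T ?I ?g x \<in> FI_lower_span W ?I"
      using hom assms(2) by (intro I map_closed) auto
    then have "fi_map W ?I T ?f (fi_map W T ?I ?g x) \<in> FI_lower_span W T"
      using map_lower_span[of ?I T ?f] hom assms(2) by auto
    also have "fi_map W ?I T ?f (fi_map W T ?I ?g x) = x"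
      using map_compose[of T ?I T ?g ?f x] hom assms(2) x map_id[OF assms(2) x]
      unfolding fg by simp
    finally show "x \<in> FI_lower_span W T" .
  qed
qed

text \<open>Above degree \<open>m\<close> everything comes from smaller sets, to which strong
  induction on \<open>card T\<close> applies.\<close>

lemma generated_by_small_subsets:
  assumes "FI_generated_in_degree W m" "finite T"
  shows "carrier (fi_obj W T) \<subseteq>
    generate (fi_obj W T) (\<Union>{FI_image W S T (carrier (fi_obj W S)) | S. S \<subseteq> T \<and> card S \<le> m})"
  using assms(2)
proof (induction "card T" arbitrary: T rule: less_induct)
  case less
  let ?U = "\<lambda>T. \<Union>{FI_image W S T (carrier (fi_obj W S)) | S. S \<subseteq> T \<and> card S \<le> m}"
  interpret T: comm_group "fi_obj W T"
    using less.prems by (rule comm_group_obj)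
  have U: "?U T \<subseteq> carrier (fi_obj W T)" if "finite T" for T
    using FI_image_carrier[OF _ that] by blast
  show ?case
  proof (cases "card T \<le> m")
    case True
    have "FI_image W T T (carrier (fi_obj W T)) = carrier (fi_obj W T)"
      using map_id[OF less.prems] by (auto simp: FI_image_def)
    then have "carrier (fi_obj W T) \<subseteq> ?U T"
      using True by blast
    then show ?thesis
      by (auto intro: generate.incl)
  next
    case False
    then have "carrier (fi_obj W T) = FI_lower_span W T"
      using lower_span_eq_carrier[OF assms(1) less.prems] by simp
    also have "\<dots> \<subseteq> generate (fi_obj W T) (?U T)"
      unfolding FI_lower_span_def
    proof (rule T.generate_subgroup_incl)
      show "subgroup (generate (fi_obj W T) (?U T)) (fi_obj W T)"
        using U[OF less.prems] by (rule T.generate_is_subgroup)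
      have "fi_map W S T f y \<in> generate (fi_obj W T) (?U T)"
        if S: "finite S" "f \<in> FI_hom S T" "card S < card T" and y: "y \<in> carrier (fi_obj W S)" for S f y
      proof -
        \<comment> \<open>The image of \<open>S\<close> is a subset of \<open>T\<close> with fewer
          elements, so the hypothesis applies to it; its generators are pushed forward along the
          inclusion.\<close>
        let ?R = "f ` S"
        note f = FI_hom_factor_image[OF S(2)]
        have "finite ?R"
          using S by simp
        interpret i: group_hom "fi_obj W ?R" "fi_obj W T" "fi_map W ?R T (FI_incl ?R)"
          using \<open>finite ?R\<close> less.prems f by (intro map_group_hom FI_incl_hom)
        have "card ?R < card T"
          using S card_image_le[OF S(1), of f] by simp
        then have "fi_map W S ?R f y \<in> generate (fi_obj W ?R) (?U ?R)"
          using less.hyps[OF _ \<open>finite ?R\<close>] map_closed[OF S(1) \<open>finite ?R\<close> f(1) y] by blast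
        then have "fi_map W ?R T (FI_incl ?R) (fi_map W S ?R f y)
            \<in> generate (fi_obj W T) (fi_map W ?R T (FI_incl ?R) ` ?U ?R)"
          using i.generate_img[OF U[OF \<open>finite ?R\<close>]] by blast
        moreover have sub: "fi_map W ?R T (FI_incl ?R) ` ?U ?R \<subseteq> ?U T"
        proof -
          have "fi_map W ?R T (FI_incl ?R) ` FI_image W Q ?R (carrier (fi_obj W Q)) \<subseteq> ?U T"
            if "Q \<subseteq> ?R" "card Q \<le> m" for Q
            using that image_FI_image[OF that(1) f(2) less.prems subset_refl] f(2) by blast
          then show ?thesis
            by blast
        qed
        moreover have "fi_map W ?R T (FI_incl ?R) (fi_map W S ?R f y) = fi_map W S T f y"
          using map_compose[OF S(1) \<open>finite ?R\<close> less.prems f(1) FI_incl_hom[OF f(2)] y] f(3) by simp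
        ultimately show ?thesis
          using T.mono_generate[OF sub] by auto
      qed
      then show "\<Union>{fi_map W S T f ` carrier (fi_obj W S) | S f.
          finite S \<and> f \<in> FI_hom S T \<and> card S < card T} \<subseteq> generate (fi_obj W T) (?U T)"
        by blast
    qed
    finally show ?thesis .
  qed
qed

definition transposition_map :: "nat set \<Rightarrow> nat \<Rightarrow> nat \<Rightarrow> 'a \<Rightarrow> 'a" where
  "transposition_map N i j = fi_map W N N (restrict (Transposition.transpose i j) N)"

lemma transposition_action:
  assumes "finite N"
  shows "transposition_action (fi_obj W N) (transposition_map N) N"
proof -
  interpret N: comm_group "fi_obj W N"
    using assms by (rule comm_group_obj)
  show ?thesis
  proof (rule transposition_action.intro[OF N.comm_group_axioms transposition_action_axioms.intro])
    show "transposition_map N i j \<in> hom (fi_obj W N) (fi_obj W N)" if "i \<in> N" "j \<in> N" for i j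
      unfolding transposition_map_def using that assms by (intro map_hom restrict_transpose_hom_self)
    fix i j k l x
    assume ij: "i \<in> N" "j \<in> N" and kl: "k \<in> N" "l \<in> N" and neq: "i \<noteq> k" "i \<noteq> l" "j \<noteq> k" "j \<noteq> l"
      and x: "x \<in> carrier (fi_obj W N)"
    let ?t = "\<lambda>i j. restrict (Transposition.transpose i j) N"
    have "compose N (?t i j) (?t k l) = compose N (?t k l) (?t i j)"
      using ij kl neq by (auto simp: compose_def fun_eq_iff Transposition.transpose_def)
    then show "transposition_map N i j (transposition_map N k l x)
        = transposition_map N k l (transposition_map N i j x)"
      unfolding transposition_map_def
      using map_compose[OF assms assms assms restrict_transpose_hom_self[OF kl] restrict_transpose_hom_self[OF ij] x]
        map_compose[OF assms assms assms restrict_transpose_hom_self[OF ij] restrict_transpose_hom_self[OF kl] x]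
      by simp
  qed
qed

text \<open>By functoriality a single structure map describes the action on the copy of
  \<open>W_T\<close>; both action axioms of \<open>subgroup_family\<close> are read off from
  it.\<close>

lemma transposition_map_incl:
  assumes "finite N" "T \<subseteq> N" "i \<in> N" "j \<in> N" "x \<in> carrier (fi_obj W T)"
  shows "transposition_map N i j (fi_map W T N (FI_incl T) x)
    = fi_map W T N (restrict (Transposition.transpose i j) T) x"
proof -
  have "compose T (restrict (Transposition.transpose i j) N) (FI_incl T)
      = restrict (Transposition.transpose i j) T"
    using assms(2) by (auto simp: compose_def FI_incl_def fun_eq_iff)
  then show ?thesis
    using map_compose[of T N N "FI_incl T" "restrict (Transposition.transpose i j) N" x] assms
      finite_subset[OF assms(2,1)]
    by (simp add: transposition_map_def FI_incl_hom restrict_transpose_hom_self)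
qed

text \<open>Functoriality supplies monotonicity and the action axioms; the degree bound supplies
  \<open>generated\<close>. At the start all points of \<open>N\<close> are admissible.\<close>

lemma subgroup_family_sub:
  assumes V: "sub_FI_module V W" and gen: "FI_generated_in_degree (sub_FI_data W V) d" and N: "finite N"
  shows "subgroup_family (fi_obj W N) (transposition_map N) N N d (\<lambda>T. FI_image W T N (V T))"
proof -
  interpret transposition_action "fi_obj W N" "transposition_map N" N
    using N by (rule transposition_action)
  have subV: "subgroup (V T) (fi_obj W T)" if "finite T" for T
    using V that by (simp add: sub_FI_module_def)
  have mapV: "fi_map W S T f x \<in> V T" if "finite S" "finite T" "f \<in> FI_hom S T" "x \<in> V S" for S T f x
    using V that unfolding sub_FI_module_def by (meson image_subset_iff)
  have carV: "V T \<subseteq> carrier (fi_obj W T)" if "finite T" for T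
    using subV[OF that] subgroup.subset by blast
  have fin: "finite T" if "T \<subseteq> N" for T
    using that N finite_subset by blast
  have hom: "group_hom (fi_obj W T) (fi_obj W N) (fi_map W T N (FI_incl T))" if "T \<subseteq> N" for T
    using that N fin by (intro map_group_hom FI_incl_hom)
  show ?thesis
  proof (rule subgroup_family.intro[OF transposition_action_axioms subgroup_family_axioms.intro])
    show "N \<subseteq> N" "finite N"
      using N by auto
    show "subgroup (FI_image W T N (V T)) (fi_obj W N)" if "T \<subseteq> N" for T
      unfolding FI_image_def using subV fin that group_hom.subgroup_img_is_subgroup[OF hom[OF that]] by blast
    show "FI_image W S N (V S) \<subseteq> FI_image W T N (V T)" if "S \<subseteq> T" "T \<subseteq> N" for S T
    proof -
      have "finite S" "finite T"
        using that fin by auto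
      then have "FI_image W S T (V S) \<subseteq> V T"
        using mapV FI_incl_hom[OF that(1)] by (auto simp: FI_image_def)
      then show ?thesis
        unfolding image_FI_image[OF that N carV[OF \<open>finite S\<close>], symmetric] FI_image_def[of W T N]
        by (rule image_mono)
    qed
    show "transposition_map N i j x \<in> FI_image W (Transposition.transpose i j ` T) N (V (Transposition.transpose i j ` T))"
      if T: "T \<subseteq> N" and ij: "i \<in> N" "j \<in> N" and x: "x \<in> FI_image W T N (V T)" for T i j x
    proof -
      let ?t = "restrict (Transposition.transpose i j) T" and ?T = "Transposition.transpose i j ` T"
      obtain y where y: "y \<in> V T" "x = fi_map W T N (FI_incl T) y"
        using x by (auto simp: FI_image_def)
      have T': "?T \<subseteq> N"
        using image_mono[OF T, of "Transposition.transpose i j"] ij by simp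
      have y': "y \<in> carrier (fi_obj W T)"
        using y carV fin[OF T] by blast
      have "compose T (FI_incl ?T) ?t = ?t"
        by (auto simp: compose_def FI_incl_def fun_eq_iff)
      then have "transposition_map N i j x = fi_map W ?T N (FI_incl ?T) (fi_map W T ?T ?t y)"
        using map_compose[OF fin[OF T] fin[OF T'] N restrict_transpose_hom FI_incl_hom[OF T'] y']
          transposition_map_incl[OF N T ij y'] y by simp
      moreover have "fi_map W T ?T ?t y \<in> V ?T"
        using y T T' fin by (intro mapV restrict_transpose_hom) auto
      ultimately show ?thesis
        by (auto simp: FI_image_def)
    qed
    show "transposition_map N i j x = x"
      if T: "T \<subseteq> N" and ij: "i \<in> N - T" "j \<in> N - T" and x: "x \<in> FI_image W T N (V T)" for T i j x
    proof -
      obtain y where y: "y \<in> V T" "x = fi_map W T N (FI_incl T) y"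
        using x by (auto simp: FI_image_def)
      have "restrict (Transposition.transpose i j) T = FI_incl T"
        using ij by (auto simp: FI_incl_def fun_eq_iff restrict_def Transposition.transpose_def)
      then show ?thesis
        using transposition_map_incl[OF N T, of i j y] ij y carV fin[OF T] by auto
    qed
    show "FI_image W T N (V T)
        \<subseteq> generate (fi_obj W N) (\<Union>{FI_image W S N (V S) | S. S \<subseteq> T \<and> card S \<le> d})"
      if T: "T \<subseteq> N" for T
    proof -
      let ?U = "\<Union>{FI_image W S T (V S) | S. S \<subseteq> T \<and> card S \<le> d}"
      interpret T: comm_group "fi_obj W T"
        using fin[OF T] by (rule comm_group_obj)
      interpret i: group_hom "fi_obj W T" "fi_obj W N" "fi_map W T N (FI_incl T)"
        using T by (rule hom)
      have "FI_image W S T (V S) \<subseteq> V T" if "S \<subseteq> T" for S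
        unfolding FI_image_def using mapV[OF _ fin[OF T] FI_incl_hom[OF that]] finite_subset[OF that fin[OF T]]
        by auto
      then have UV: "?U \<subseteq> V T"
        by blast
      \<comment> \<open>The degree bound gives generation inside the group \<open>V T\<close>; this
        agrees with generation in \<open>W_T\<close>, and the inclusion map carries it to
        \<open>W_N\<close>.\<close>
      interpret V: FI_module "sub_FI_data W V"
        by (rule FI_module_sub_FI_data[OF FI_module_axioms V])
      have "V T \<subseteq> generate ((fi_obj W T)\<lparr>carrier := V T\<rparr>) ?U"
        using V.generated_by_small_subsets[OF gen fin[OF T]] by (simp add: sub_FI_data_def FI_image_def)
      also have "\<dots> = generate (fi_obj W T) ?U"
        using UV subV[OF fin[OF T]] by (rule T.generate_consistent)
      finally have "FI_image W T N (V T) \<subseteq> generate (fi_obj W N) (fi_map W T N (FI_incl T) ` ?U)"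
        using i.generate_img[of ?U] UV carV[OF fin[OF T]] by (auto simp: FI_image_def)
      also have "\<dots> \<subseteq> generate (fi_obj W N) (\<Union>{FI_image W S N (V S) | S. S \<subseteq> T \<and> card S \<le> d})"
      proof (rule mono_generate, safe)
        fix x S assume S: "S \<subseteq> T" "card S \<le> d" and x: "x \<in> FI_image W S T (V S)"
        have "fi_map W T N (FI_incl T) ` FI_image W S T (V S) = FI_image W S N (V S)"
          using S T N carV fin by (intro image_FI_image) auto
        then have "fi_map W T N (FI_incl T) x \<in> FI_image W S N (V S)"
          using x by blast
        then show "fi_map W T N (FI_incl T) x \<in> \<Union>{FI_image W S N (V S) | S. S \<subseteq> T \<and> card S \<le> d}"
          using S by blast
      qed
      finally show ?thesis .
    qed
  qed
qed

text \<open>Regarding \<open>W\<close> as its own submodule makes \<open>subgroup_family_sub\<close>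
  available for \<open>W\<close> in its own generating degree.\<close>

lemma sub_FI_module_carrier: "sub_FI_module (\<lambda>T. carrier (fi_obj W T)) W"
  unfolding sub_FI_module_def
  using comm_group_obj map_closed by (auto intro!: group.subgroup_self comm_group.axioms(2))

lemma sub_FI_data_carrier: "sub_FI_data W (\<lambda>T. carrier (fi_obj W T)) = W"
  by (simp add: sub_FI_data_def)

end

section \<open>Passage from \<open>[n]\<close> to \<open>[2n]\<close> and back\<close>

theorem theoremE:
  fixes k d n a :: nat
    and M :: "'a FI_data"
    and V :: "nat set \<Rightarrow> 'a set"
  assumes "FI_module M"
    and "FI_torsion_free M"
    and "FI_generated_in_degree M k"
    and "sub_FI_module V M"
    and "FI_generated_in_degree (sub_FI_data M V) d"
    and "n > min k d + d"
    and "a \<le> n"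
  shows "V {1..n} \<inter> subgroup_sum (fi_obj M {1..n}) {1..a}
            (\<lambda>i. FI_image M ({1..n} - {i}) {1..n} (carrier (fi_obj M ({1..n} - {i}))))
       = subgroup_sum (fi_obj M {1..n}) {1..a}
            (\<lambda>i. FI_image M ({1..n} - {i}) {1..n} (V ({1..n} - {i})))"
proof -
  interpret FI_module M
    by fact
  let ?I = "{1..n}" and ?N = "{1..2 * n}" and ?\<tau> = "transposition_map {1..2 * n}"
  let ?G = "fi_obj M ?N" and ?C = "\<lambda>T. carrier (fi_obj M T)" and ?\<iota> = "fi_map M ?I ?N (FI_incl ?I)"
  have IN: "?I \<subseteq> ?N" "finite ?I" "finite ?N"
    by auto
  have sub: "subgroup (V T) (fi_obj M T)" "V T \<subseteq> ?C T" if "finite T" for T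
    using assms(4) that subgroup.subset by (auto simp: sub_FI_module_def)
  interpret I: comm_group "fi_obj M ?I"
    by (rule comm_group_obj) simp
  interpret \<iota>: group_hom "fi_obj M ?I" ?G ?\<iota>
    using IN by (intro map_group_hom FI_incl_hom)
  interpret V: subgroup_family ?G ?\<tau> ?N ?N d "\<lambda>T. FI_image M T ?N (V T)"
    using assms(4,5) IN(3) by (rule subgroup_family_sub)
  interpret C: subgroup_family ?G ?\<tau> ?N ?N k "\<lambda>T. FI_image M T ?N (?C T)"
    using subgroup_family_sub[OF sub_FI_module_carrier _ IN(3)] assms(3) by (simp add: sub_FI_data_carrier)
  have sub_del: "subgroup (FI_image M (?I - {i}) ?I (A (?I - {i}))) (fi_obj M ?I)"
    if "\<And>T. finite T \<Longrightarrow> subgroup (A T) (fi_obj M T)" for A i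
    unfolding FI_image_def
    by (rule group_hom.subgroup_img_is_subgroup[OF map_group_hom]) (auto intro!: FI_incl_hom that)
  have sumV: "subgroup_sum (fi_obj M ?I) {1..a} (\<lambda>i. FI_image M (?I - {i}) ?I (V (?I - {i})))
      = generate (fi_obj M ?I) (\<Union>i\<in>{1..a}. FI_image M (?I - {i}) ?I (V (?I - {i})))" (is "_ = ?RV")
    by (intro subgroup_sum_eq_generate[OF I.comm_group_axioms] sub_del[of V] sub(1)) auto
  have sumC: "subgroup_sum (fi_obj M ?I) {1..a} (\<lambda>i. FI_image M (?I - {i}) ?I (?C (?I - {i})))
      = generate (fi_obj M ?I) (\<Union>i\<in>{1..a}. FI_image M (?I - {i}) ?I (?C (?I - {i})))" (is "_ = ?RC")
    using sub_FI_module_carrier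
    by (intro subgroup_sum_eq_generate[OF I.comm_group_axioms] sub_del[of ?C])
      (auto simp: sub_FI_module_def)
  \<comment> \<open>Applied with \<open>A = V\<close> and \<open>A = ?C\<close>, this carries both
    sums over \<open>[n]\<close> into the ambient module.\<close>
  have image: "?\<iota> ` generate (fi_obj M ?I) (\<Union>i\<in>{1..a}. FI_image M (?I - {i}) ?I (A (?I - {i})))
      = generate ?G (\<Union>i\<in>{1..a}. FI_image M (?I - {i}) ?N (A (?I - {i})))"
    if A: "\<And>T. finite T \<Longrightarrow> A T \<subseteq> ?C T" for A
  proof -
    have "(\<Union>i\<in>{1..a}. FI_image M (?I - {i}) ?I (A (?I - {i}))) \<subseteq> ?C ?I"
      using A by (intro UN_least FI_image_carrier) auto
    from \<iota>.generate_img[OF this] show ?thesis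
      using image_FI_image[OF _ IN(1,3) A] by (simp add: image_UN)
  qed
  \<comment> \<open>For \<open>k < d\<close> the products kill all of \<open>M\<close>, hence also
    \<open>V\<close>; otherwise the generating degree of \<open>V\<close> gives the bound.\<close>
  have kills: "V.kills (Suc (min k d)) (FI_image M ?N ?N (V ?N)) ?N"
  proof (cases "d \<le> k")
    case True
    then show ?thesis
      using V.kills_generating_degree by (simp add: min_def)
  next
    case False
    moreover have "FI_image M ?N ?N (V ?N) \<subseteq> FI_image M ?N ?N (?C ?N)"
      using sub(2)[OF IN(3)] by (auto simp: FI_image_def)
    ultimately show ?thesis
      using C.kills_generating_degree unfolding V.kills_def by (auto simp: min_def)
  qed
  have "V ?I \<inter> ?RC = ?RV"
  proof
    have "FI_image M (?I - {i}) ?I (V (?I - {i})) \<subseteq> V ?I" for i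
      using assms(4) FI_incl_hom[of "?I - {i}" ?I] by (simp add: sub_FI_module_def FI_image_def)
    then have "?RV \<subseteq> V ?I"
      by (intro I.generate_subgroup_incl UN_least sub) auto
    moreover have "?RV \<subseteq> ?RC"
      using sub(2) by (intro I.mono_generate UN_mono) (auto simp: FI_image_def)
    ultimately show "?RV \<subseteq> V ?I \<inter> ?RC"
      by blast
    show "V ?I \<inter> ?RC \<subseteq> ?RV"
    proof safe
      fix v assume v: "v \<in> V ?I" "v \<in> ?RC"
      have "?\<iota> v \<in> generate ?G (\<Union>i\<in>{1..a}. FI_image M (?I - {i}) ?N (?C (?I - {i})))"
        using image[of ?C] v(2) by blast
      \<comment> \<open>The outside position of \<open>i\<close> is \<open>i + n\<close>; both
        points miss \<open>[n] - {i}\<close>, so their transposition fixes the copy of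
        \<open>M\<close> over that set.\<close>
      also have "\<dots> \<subseteq> generate ?G (\<Union>i\<in>{1..a}. V.fixed i (i + n))"
        using assms(7) by (intro \<iota>.H.mono_generate UN_mono C.trivial_fixed) auto
      finally have "?\<iota> v \<in> generate ?G (\<Union>i\<in>{1..a}. FI_image M (?I - {i}) ?N (V (?I - {i})))"
        using assms(6,7) v(1)
        by (intro sum_of_fixed_mem[OF V.subgroup_family_axioms kills, where s = "\<lambda>i. i + n"])
          (auto simp: FI_image_def)
      then obtain v' where v': "v' \<in> ?RV" "?\<iota> v = ?\<iota> v'"
        using image[of V] sub(2) by blast
      \<comment> \<open>Torsion-freeness brings the conclusion back from \<open>[2n]\<close>:
        elements of \<open>M_n\<close> with equal images agree.\<close>
      have "inj_on ?\<iota> (?C ?I)"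
        using assms(2) IN FI_incl_hom[OF IN(1)] by (simp add: FI_torsion_free_def)
      moreover have "v' \<in> ?C ?I"
        using v'(1) by (rule I.generate_in_carrier[rotated])
          (intro UN_least FI_image_carrier sub, auto)
      ultimately have "v = v'"
        using v'(2) subsetD[OF sub(2)[OF IN(2)] v(1)] by (blast dest: inj_onD)
      then show "v \<in> ?RV"
        using v'(1) by simp
    qed
  qed
  then show ?thesis
    unfolding sumV sumC .
qed

end
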